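(* Let $M$ be a monoid, let $A$ be an $M$-act and let $B$ be a subact of $A$. Let $\langle X\,|\,R\rangle$ and $\langle Y\,|\,S\rangle$ be presentations for $B$ and $A/B$ respectively (with $X\subseteq B$ and $Y\subseteq A/B$ generating sets), and let $Y'=Y\setminus\{0\}$, regarded as a subset of $A\setminus B$. If $A\setminus B$ is not closed under the action of $M$ on $A$, then for each $w\in F_{Y'}$ that represents $0$ in $A/B$ choose $\alpha_w\in F_X$ such that $w=\alpha_w$ in $A$, and fix one such $w$, denoted $z$. Define $$S_1=\{(u,v)\in S : u\text{ represents an element of }A\setminus B\},$$ $$S_2=\{u=\alpha_u : u\in F_{Y'},\ u=0\text{ in }A/B,\ (u,v)\in\overline{S}\text{ for some }v\in F_Y\}\cup\{z=\alpha_z\},$$ where $S_2$ is empty if $A\setminus B$ is closed under the action of $M$. Then $A$ is defined by the presentation $\langle X\cup Y'\,|\,R\cup S_1\cup S_2\rangle$.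
   Context: Let $M$ be a monoid with identity $1$. A (right) $M$-act is a non-empty set $A$ with a map $A\times M\to A$, $(a,m)\mapsto am$, with $a(mn)=(am)n$ and $a1=a$. A subact of $A$ is a non-empty subset $B$ with $bm\in B$ for all $b\in B$, $m\in M$. A subset $U$ generates $A$ if every $a\in A$ is $um$ for some $u\in U$, $m\in M$. A congruence on $A$ is an equivalence relation $\rho$ with $(a,b)\in\rho\Rightarrow(am,bm)\in\rho$ for all $m\in M$. For a set $X$, $F_X=X\times M$ is the free $M$-act with $(x,m)n=(x,mn)$; one writes $x\cdot m$ for $(x,m)$ and $x$ for $(x,1)$. For $X\subseteq Z$ we regard $F_X\subseteq F_Z$. A presentation $\langle X\,|\,R\rangle$ consists of a non-empty set $X$ and a set $R\subseteq F_X\times F_X$ of relations; $(u,v)\in R$ is also written $u=v$. An $M$-act $A$ is defined by $\langle X\,|\,R\rangle$ if $A\cong F_X/\rho$, where $\rho$ is the smallest congruence on $F_X$ containing $R$. The generators $X$ are regarded as elements of the act (a generating set), so that $x\cdot m\in F_X$ represents the element $xm$; "$w_1=w_2$ in $A$" means that $w_1,w_2$ represent the same element of $A$. For a relation $T$ on a set, $\overline{T}=T\cup\{(u,v):(v,u)\in T\}$. For a subact $B$ of $A$, the Rees quotient $A/B$ is the quotient of $A$ by the congruence $a\,\rho_B\,b\iff a=b$ or $a,b\in B$; the class $B$ is denoted $0$ and the class $\{a\}$ with $a\in A\setminus B$ is identified with $a$. *)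

theory Defs
  imports "HOL-Algebra.Group"
begin

locale monoid_act = monoid M for M :: "('m, 'k) monoid_scheme" (structure) +
  fixes A :: "'a set" and act :: "'a \<Rightarrow> 'm \<Rightarrow> 'a"
  assumes act_nonempty: "A \<noteq> {}"
    and act_closed: "\<lbrakk>a \<in> A; m \<in> carrier M\<rbrakk> \<Longrightarrow> act a m \<in> A"
    and act_mult: "\<lbrakk>a \<in> A; m \<in> carrier M; n \<in> carrier M\<rbrakk> \<Longrightarrow> act a (m \<otimes> n) = act (act a m) n"
    and act_one: "a \<in> A \<Longrightarrow> act a \<one> = a"

definition closed_under :: "('m, 'k) monoid_scheme \<Rightarrow> ('a \<Rightarrow> 'm \<Rightarrow> 'a) \<Rightarrow> 'a set \<Rightarrow> bool" where
  "closed_under M act C \<longleftrightarrow> (\<forall>c\<in>C. \<forall>m\<in>carrier M. act c m \<in> C)"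

definition subact :: "('m, 'k) monoid_scheme \<Rightarrow> 'a set \<Rightarrow> ('a \<Rightarrow> 'm \<Rightarrow> 'a) \<Rightarrow> 'a set \<Rightarrow> bool" where
  "subact M A act B \<longleftrightarrow> B \<noteq> {} \<and> B \<subseteq> A \<and> closed_under M act B"

definition act_congruence ::
    "('m, 'k) monoid_scheme \<Rightarrow> 'a set \<Rightarrow> ('a \<Rightarrow> 'm \<Rightarrow> 'a) \<Rightarrow> ('a \<times> 'a) set \<Rightarrow> bool" where
  "act_congruence M A act \<rho> \<longleftrightarrow>
     equiv A \<rho> \<and> (\<forall>(a, b)\<in>\<rho>. \<forall>m\<in>carrier M. (act a m, act b m) \<in> \<rho>)"

definition congruence_generated ::
    "('m, 'k) monoid_scheme \<Rightarrow> 'a set \<Rightarrow> ('a \<Rightarrow> 'm \<Rightarrow> 'a) \<Rightarrow> ('a \<times> 'a) set \<Rightarrow> ('a \<times> 'a) set" where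
  "congruence_generated M A act R = \<Inter> {\<rho>. act_congruence M A act \<rho> \<and> R \<subseteq> \<rho>}"

text \<open>The action on the quotient \<open>A // \<rho>\<close>. On a class \<open>C\<close> of a congruence \<open>\<rho>\<close> all the
  elements \<open>act c m\<close> with \<open>c \<in> C\<close> lie in a single class, which is the value.\<close>
definition quotient_act :: "('a \<times> 'a) set \<Rightarrow> ('a \<Rightarrow> 'm \<Rightarrow> 'a) \<Rightarrow> 'a set \<Rightarrow> 'm \<Rightarrow> 'a set" where
  "quotient_act \<rho> act C m = \<rho> `` ((\<lambda>c. act c m) ` C)"

definition act_iso ::
    "('m, 'k) monoid_scheme \<Rightarrow> 'a set \<Rightarrow> ('a \<Rightarrow> 'm \<Rightarrow> 'a) \<Rightarrow> 'b set \<Rightarrow> ('b \<Rightarrow> 'm \<Rightarrow> 'b) \<Rightarrow> ('a \<Rightarrow> 'b) \<Rightarrow> bool" where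
  "act_iso M A act A' act' \<phi> \<longleftrightarrow>
     bij_betw \<phi> A A' \<and> (\<forall>a\<in>A. \<forall>m\<in>carrier M. \<phi> (act a m) = act' (\<phi> a) m)"

definition free_act :: "('m, 'k) monoid_scheme \<Rightarrow> 'x set \<Rightarrow> ('x \<times> 'm) set" where
  "free_act M X = X \<times> carrier M"

definition free_action :: "('m, 'k) monoid_scheme \<Rightarrow> 'x \<times> 'm \<Rightarrow> 'm \<Rightarrow> 'x \<times> 'm" where
  "free_action M w n = (fst w, snd w \<otimes>\<^bsub>M\<^esub> n)"

text \<open>The generators are elements of the act presented, and the isomorphism
  \<open>F\<^sub>X/\<rho> \<cong> A\<close> is required to send the class of the generator \<open>x = (x, 1)\<close> to \<open>x\<close> itself, so that
  \<open>(x, m)\<close> represents the element \<open>act x m\<close>.\<close>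
definition defined_by ::
    "('m, 'k) monoid_scheme \<Rightarrow> 'a set \<Rightarrow> ('a \<Rightarrow> 'm \<Rightarrow> 'a) \<Rightarrow> 'a set \<Rightarrow> (('a \<times> 'm) \<times> ('a \<times> 'm)) set \<Rightarrow> bool" where
  "defined_by M A act X R \<longleftrightarrow>
     X \<noteq> {} \<and> X \<subseteq> A \<and> R \<subseteq> free_act M X \<times> free_act M X \<and>
     (let \<rho> = congruence_generated M (free_act M X) (free_action M) R in
        \<exists>\<phi>. act_iso M (free_act M X // \<rho>) (quotient_act \<rho> (free_action M)) A act \<phi> \<and>
            (\<forall>x\<in>X. \<phi> (\<rho> `` {(x, \<one>\<^bsub>M\<^esub>)}) = x))"

definition represented :: "('a \<Rightarrow> 'm \<Rightarrow> 'a) \<Rightarrow> 'a \<times> 'm \<Rightarrow> 'a" where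
  "represented act w = act (fst w) (snd w)"

definition rees_congruence :: "'a set \<Rightarrow> 'a set \<Rightarrow> ('a \<times> 'a) set" where
  "rees_congruence A B = {(a, b). a \<in> A \<and> b \<in> A \<and> (a = b \<or> (a \<in> B \<and> b \<in> B))}"

text \<open>The elements of \<open>A/B\<close> are the classes themselves: \<open>B\<close>, which is the zero, and the
  singletons \<open>{a}\<close> with \<open>a \<in> A - B\<close>. The identification of \<open>{a}\<close> with \<open>a\<close> is made explicit
  by \<open>word_to_rees\<close> and \<open>word_of_rees\<close>, which relabel the generator of a word.\<close>
definition rees_quotient :: "'a set \<Rightarrow> 'a set \<Rightarrow> 'a set set" where
  "rees_quotient A B = A // rees_congruence A B"

definition rees_action :: "'a set \<Rightarrow> ('a \<Rightarrow> 'm \<Rightarrow> 'a) \<Rightarrow> 'a set \<Rightarrow> 'a set \<Rightarrow> 'm \<Rightarrow> 'a set" where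
  "rees_action A act B = quotient_act (rees_congruence A B) act"

definition word_to_rees :: "'a \<times> 'm \<Rightarrow> 'a set \<times> 'm" where
  "word_to_rees = map_prod (\<lambda>a. {a}) id"

definition word_of_rees :: "'a set \<times> 'm \<Rightarrow> 'a \<times> 'm" where
  "word_of_rees = map_prod the_elem id"

end

theory Submission
  imports Defs
begin

text \<open>An act is defined by \<open>\<langle>X | R\<rangle>\<close> iff \<open>R\<close> generates the kernel of the representation map on
  the free act and this map is onto. Every relation of \<open>\<langle>X \<union> Y' | R \<union> S\<^sub>1 \<union> S\<^sub>2\<rangle>\<close> holds in \<open>A\<close>;
  let \<open>\<rho>\<close> be the congruence it generates. The words \<open>\<rho>\<close>-related to words over \<open>X\<close> form a
  subact \<open>D\<close> of the free act, and collapsing \<open>D\<close>, together with all words over the generator \<open>0\<close>,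
  gives a congruence on the free act on \<open>Y\<close> which contains \<open>S\<close>, hence contains equality in \<open>A/B\<close>.
  So two words with the same value in \<open>A - B\<close>, which cannot lie in \<open>D\<close>, are \<open>\<rho>\<close>-related. A word
  over \<open>Y'\<close> with value in \<open>B\<close> equals \<open>z\<close> in \<open>A/B\<close>, so it lies in \<open>D\<close> because \<open>z = \<alpha>\<^sub>z\<close> puts \<open>z\<close>
  there; this reduces equality of values in \<open>B\<close> to the relations \<open>R\<close>.\<close>

section \<open>Congruences of acts and their quotients\<close>

lemma act_congruenceI:
  assumes "\<rho> \<subseteq> A \<times> A" and "\<And>a. a \<in> A \<Longrightarrow> (a, a) \<in> \<rho>"
    and "\<And>a b. (a, b) \<in> \<rho> \<Longrightarrow> (b, a) \<in> \<rho>"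
    and "\<And>a b c. \<lbrakk>(a, b) \<in> \<rho>; (b, c) \<in> \<rho>\<rbrakk> \<Longrightarrow> (a, c) \<in> \<rho>"
    and "\<And>a b m. \<lbrakk>(a, b) \<in> \<rho>; m \<in> carrier M\<rbrakk> \<Longrightarrow> (act a m, act b m) \<in> \<rho>"
  shows "act_congruence M A act \<rho>"
  unfolding act_congruence_def
  by (intro conjI equivI refl_onI symI transI) (use assms in blast)+

lemma act_congruenceD:
  assumes "act_congruence M A act \<rho>"
  shows "\<rho> \<subseteq> A \<times> A" and "a \<in> A \<Longrightarrow> (a, a) \<in> \<rho>"
    and "(a, b) \<in> \<rho> \<Longrightarrow> (b, a) \<in> \<rho>"
    and "\<lbrakk>(a, b) \<in> \<rho>; (b, c) \<in> \<rho>\<rbrakk> \<Longrightarrow> (a, c) \<in> \<rho>"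
    and "\<lbrakk>(a, b) \<in> \<rho>; m \<in> carrier M\<rbrakk> \<Longrightarrow> (act a m, act b m) \<in> \<rho>"
  using assms unfolding act_congruence_def equiv_def refl_on_def sym_def trans_def by blast+

lemma congruence_generated_least:
  assumes "act_congruence M A act \<rho>" and "R \<subseteq> \<rho>"
  shows "congruence_generated M A act R \<subseteq> \<rho>"
  using assms unfolding congruence_generated_def by blast

lemma congruence_generated_superset: "R \<subseteq> congruence_generated M A act R"
  unfolding congruence_generated_def by blast

text \<open>The total relation on \<open>A\<close> is a congruence containing \<open>R\<close>, so
  the intersection runs over a non-empty family and stays inside
  \<open>A \<times> A\<close>.\<close>

lemma act_congruence_generated:
  assumes R: "R \<subseteq> A \<times> A" and act: "closed_under M act A"
  shows "act_congruence M A act (congruence_generated M A act R)"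
proof (rule act_congruenceI)
  have "act_congruence M A act (A \<times> A)"
    using act by (intro act_congruenceI) (auto simp: closed_under_def)
  then show "congruence_generated M A act R \<subseteq> A \<times> A"
    using R by (rule congruence_generated_least)
qed (auto simp: congruence_generated_def intro: act_congruenceD(2,3,5),
     blast intro: act_congruenceD(4))

lemma act_congruence_restrict:
  assumes "act_congruence M A act \<rho>" and "B \<subseteq> A" and "closed_under M act B"
  shows "act_congruence M B act (\<rho> \<inter> B \<times> B)"
  using assms(2,3) act_congruenceD[OF assms(1)] unfolding closed_under_def
  by (intro act_congruenceI) blast+

text \<open>Compatibility puts all \<open>act c m\<close>, for \<open>c\<close> in the class of
  \<open>a\<close>, into the class of \<open>act a m\<close>; so the action can be computed on any
  representative.\<close>

lemma quotient_act_class: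
  assumes "act_congruence M A act \<rho>" and "a \<in> A" and "m \<in> carrier M"
  shows "quotient_act \<rho> act (\<rho> `` {a}) m = \<rho> `` {act a m}"
  using assms(2,3) act_congruenceD[OF assms(1)] unfolding quotient_act_def by blast

section \<open>Free acts, representation of words, presentations\<close>

lemma free_action_closed: "Group.monoid M \<Longrightarrow> closed_under M (free_action M) (free_act M X)"
  by (auto simp: closed_under_def free_action_def free_act_def intro: monoid.m_closed)

lemma free_act_mono: "X \<subseteq> Z \<Longrightarrow> free_act M X \<subseteq> free_act M Z"
  by (auto simp: free_act_def)

text \<open>This is the relation "u = v in the act" on words. As a set it can be compared directly
  with a generated congruence, without passing to quotients.\<close>

definition representation_kernel ::
    "('m, 'k) monoid_scheme \<Rightarrow> ('a \<Rightarrow> 'm \<Rightarrow> 'a) \<Rightarrow> 'a set \<Rightarrow> (('a \<times> 'm) \<times> ('a \<times> 'm)) set" where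
  "representation_kernel M act X =
     {(u, v) \<in> free_act M X \<times> free_act M X. represented act u = represented act v}"

lemma (in monoid_act) represented_in: "\<lbrakk>X \<subseteq> A; u \<in> free_act M X\<rbrakk> \<Longrightarrow> represented act u \<in> A"
  by (auto simp: represented_def free_act_def intro!: act_closed)

lemma (in monoid_act) represented_free_action:
  "\<lbrakk>X \<subseteq> A; u \<in> free_act M X; m \<in> carrier M\<rbrakk>
     \<Longrightarrow> represented act (free_action M u m) = act (represented act u) m"
  by (auto simp: represented_def free_act_def free_action_def act_mult)

lemma (in monoid_act) act_congruence_representation_kernel:
  assumes "X \<subseteq> A"
  shows "act_congruence M (free_act M X) (free_action M) (representation_kernel M act X)"
  using free_action_closed[OF monoid_axioms, of X] represented_free_action[OF assms]
  by (intro act_congruenceI) (auto simp: representation_kernel_def closed_under_def)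

text \<open>Since \<open>(x, m)\<close> is \<open>(x, 1)\<close> acted on by \<open>m\<close>, an
  isomorphism that fixes the generators must send the class of each word to its value. Its
  injectivity then identifies the kernel, and its surjectivity shows that \<open>X\<close>
  generates.\<close>

lemma defined_byD:
  assumes M: "Group.monoid M" and D: "defined_by M A act X R"
  shows "X \<noteq> {}" "X \<subseteq> A" "R \<subseteq> free_act M X \<times> free_act M X"
    and "congruence_generated M (free_act M X) (free_action M) R = representation_kernel M act X"
    and "represented act ` free_act M X = A"
proof -
  interpret monoid M by (rule M)
  let ?F = "free_act M X"
  define \<rho> where "\<rho> = congruence_generated M ?F (free_action M) R"
  show R: "X \<noteq> {}" "X \<subseteq> A" "R \<subseteq> ?F \<times> ?F"
    using D unfolding defined_by_def by auto
  have cong: "act_congruence M ?F (free_action M) \<rho>"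
    unfolding \<rho>_def by (intro act_congruence_generated R free_action_closed M)
  then have eq: "equiv ?F \<rho>" by (simp add: act_congruence_def)
  obtain \<phi> where iso: "act_iso M (?F // \<rho>) (quotient_act \<rho> (free_action M)) A act \<phi>"
    and gen: "\<And>x. x \<in> X \<Longrightarrow> \<phi> (\<rho> `` {(x, \<one>\<^bsub>M\<^esub>)}) = x"
    using D unfolding defined_by_def \<rho>_def[symmetric] Let_def by auto
  have rep: "\<phi> (\<rho> `` {u}) = represented act u" if F: "u \<in> ?F" for u
  proof -
    obtain x m where u: "u = (x, m)" "x \<in> X" "m \<in> carrier M"
      using F by (auto simp: free_act_def)
    have x: "(x, \<one>\<^bsub>M\<^esub>) \<in> ?F" using u by (simp add: free_act_def)
    have "\<rho> `` {u} = quotient_act \<rho> (free_action M) (\<rho> `` {(x, \<one>\<^bsub>M\<^esub>)}) m"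
      using u by (simp add: quotient_act_class[OF cong x u(3)] free_action_def)
    moreover have "\<phi> \<dots> = act (\<phi> (\<rho> `` {(x, \<one>\<^bsub>M\<^esub>)})) m"
      using iso u(3) quotientI[OF x] unfolding act_iso_def by blast
    ultimately show ?thesis using gen u by (simp add: represented_def)
  qed
  have bij: "bij_betw \<phi> (?F // \<rho>) A" using iso by (simp add: act_iso_def)
  have "(u, v) \<in> \<rho> \<longleftrightarrow> represented act u = represented act v" if "u \<in> ?F" "v \<in> ?F" for u v
  proof -
    have "(u, v) \<in> \<rho> \<longleftrightarrow> \<rho> `` {u} = \<rho> `` {v}"
      using eq_equiv_class_iff[OF eq that] by simp
    also have "\<dots> \<longleftrightarrow> \<phi> (\<rho> `` {u}) = \<phi> (\<rho> `` {v})"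
      using inj_on_eq_iff[OF bij_betw_imp_inj_on[OF bij]] that by (simp add: quotientI)
    finally show ?thesis using rep that by simp
  qed
  then show "congruence_generated M ?F (free_action M) R = representation_kernel M act X"
    using act_congruenceD(1)[OF cong] unfolding \<rho>_def[symmetric] representation_kernel_def by auto
  have "represented act ` ?F = \<phi> ` (?F // \<rho>)"
    unfolding quotient_def by (simp add: image_UN UNION_singleton_eq_range image_image rep)
  then show "represented act ` ?F = A"
    using bij_betw_imp_surj_on[OF bij] by simp
qed

text \<open>Minimality of the generated congruence supplies the inclusion missing from
  \<open>ker\<close>; the isomorphism is then the one induced by evaluating words.\<close>

lemma (in monoid_act) defined_byI:
  assumes X: "X \<noteq> {}" "X \<subseteq> A" and R: "R \<subseteq> representation_kernel M act X"
    and ker: "representation_kernel M act X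
                \<subseteq> congruence_generated M (free_act M X) (free_action M) R"
    and surj: "A \<subseteq> represented act ` free_act M X"
  shows "defined_by M A act X R"
proof -
  let ?F = "free_act M X"
  define \<rho> where "\<rho> = representation_kernel M act X"
  have cong: "act_congruence M ?F (free_action M) \<rho>"
    unfolding \<rho>_def using X(2) by (rule act_congruence_representation_kernel)
  have gen: "congruence_generated M ?F (free_action M) R = \<rho>"
    using congruence_generated_least[OF cong] R ker by (auto simp: \<rho>_def)
  \<comment> \<open>All words in a class of the kernel have the same value, so the image is a
    singleton and \<open>the_elem\<close> extracts that value.\<close>
  define \<phi> where "\<phi> C = the_elem (represented act ` C)" for C
  have rep: "\<phi> (\<rho> `` {u}) = represented act u" if "u \<in> ?F" for u
  proof -
    have "represented act ` \<rho> `` {u} = {represented act u}"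
      using that by (auto simp: \<rho>_def representation_kernel_def image_iff)
    then show ?thesis by (simp add: \<phi>_def)
  qed
  have "inj_on \<phi> (?F // \<rho>)"
  proof (rule inj_onI)
    fix C D assume "C \<in> ?F // \<rho>" "D \<in> ?F // \<rho>" and eq: "\<phi> C = \<phi> D"
    then obtain u v where "u \<in> ?F" "C = \<rho> `` {u}" "v \<in> ?F" "D = \<rho> `` {v}"
      by (auto elim!: quotientE)
    with eq rep show "C = D"
      by (auto simp: \<rho>_def representation_kernel_def)
  qed
  moreover have "\<phi> ` (?F // \<rho>) = A"
  proof -
    have "\<phi> ` (?F // \<rho>) = represented act ` ?F"
      unfolding quotient_def by (simp add: image_UN UNION_singleton_eq_range image_image rep)
    then show ?thesis using surj represented_in[OF X(2)] by auto
  qed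
  moreover have "\<phi> (quotient_act \<rho> (free_action M) C m) = act (\<phi> C) m"
    if C: "C \<in> ?F // \<rho>" and m: "m \<in> carrier M" for C m
  proof -
    obtain u where u: "u \<in> ?F" "C = \<rho> `` {u}" using C by (auto elim: quotientE)
    then have "free_action M u m \<in> ?F"
      using free_action_closed[OF monoid_axioms, of X] m by (auto simp: closed_under_def)
    then show ?thesis
      using u m by (simp add: quotient_act_class[OF cong] rep represented_free_action[OF X(2)])
  qed
  moreover have "\<phi> (\<rho> `` {(x, \<one>)}) = x" if "x \<in> X" for x
  proof -
    have "(x, \<one>) \<in> ?F" using that by (simp add: free_act_def)
    then show ?thesis using rep that X(2) by (auto simp: represented_def act_one)
  qed
  moreover have "R \<subseteq> ?F \<times> ?F" using R by (auto simp: representation_kernel_def)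
  ultimately show ?thesis
    unfolding defined_by_def act_iso_def bij_betw_def Let_def gen using X by blast
qed

section \<open>Subacts and Rees quotients\<close>

lemma monoid_act_subact:
  assumes "monoid_act M A act" and "subact M A act B"
  shows "monoid_act M B act"
proof -
  interpret monoid_act M A act by (rule assms(1))
  show ?thesis
    using assms(2) by unfold_locales (auto simp: subact_def closed_under_def act_mult act_one)
qed

lemma rees_quotient_iff:
  assumes "B \<noteq> {}" "B \<subseteq> A"
  shows "C \<in> rees_quotient A B \<longleftrightarrow> C = B \<or> (\<exists>a\<in>A - B. C = {a})"
proof -
  have B: "rees_congruence A B `` {a} = B" if "a \<in> B" for a
    using that assms by (auto simp: rees_congruence_def)
  have A: "rees_congruence A B `` {a} = {a}" if "a \<in> A - B" for a
    using that by (auto simp: rees_congruence_def)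
  show ?thesis
  proof
    assume "C \<in> rees_quotient A B"
    then obtain a where "a \<in> A" "C = rees_congruence A B `` {a}"
      unfolding rees_quotient_def by (rule quotientE)
    then show "C = B \<or> (\<exists>a\<in>A - B. C = {a})" using A B by (cases "a \<in> B") auto
  next
    assume "C = B \<or> (\<exists>a\<in>A - B. C = {a})"
    then obtain a where "a \<in> A" "C = rees_congruence A B `` {a}"
      using A B assms by (metis DiffD1 ex_in_conv subsetD)
    then show "C \<in> rees_quotient A B" unfolding rees_quotient_def by (simp add: quotientI)
  qed
qed

lemma rees_action_zero:
  assumes "subact M A act B" "m \<in> carrier M"
  shows "rees_action A act B B m = B"
  using assms
  by (auto simp: rees_action_def quotient_act_def rees_congruence_def subact_def closed_under_def
        Image_def)

lemma (in monoid_act) rees_action_singleton: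
  assumes "subact M A act B" "a \<in> A" "m \<in> carrier M"
  shows "rees_action A act B {a} m = (if act a m \<in> B then B else {act a m})"
  using assms act_closed[of a m]
  by (auto simp: rees_action_def quotient_act_def rees_congruence_def subact_def)

text \<open>Here \<open>\<rho>\<close> plays the role of equality of words over \<open>X \<union> Y'\<close>, and \<open>Z u\<close> says that \<open>u\<close> is to be
  identified with zero. A word over \<open>B\<close>, the zero of \<open>A/B\<close>, has no counterpart over \<open>X \<union> Y'\<close>,
  since \<open>word_of_rees\<close> is meaningless on it.\<close>
lemma act_congruence_collapse:
  fixes \<rho> :: "(('a \<times> 'm) \<times> ('a \<times> 'm)) set"
  assumes M: "Group.monoid M"
    and cong: "act_congruence M (free_act M (X \<union> Y')) (free_action M) \<rho>"
    and Y': "\<And>C. C \<in> Y - {B} \<Longrightarrow> the_elem C \<in> Y'"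
  defines "Z \<equiv> \<lambda>u. fst u = B \<or> (\<exists>\<beta>\<in>free_act M X. (word_of_rees u, \<beta>) \<in> \<rho>)"
  shows "act_congruence M (free_act M Y) (free_action M)
    {(u, v) \<in> free_act M Y \<times> free_act M Y.
      Z u \<and> Z v \<or> fst u \<noteq> B \<and> fst v \<noteq> B \<and> (word_of_rees u, word_of_rees v) \<in> \<rho>}"
proof -
  note [intro] = act_congruenceD(3,4)[OF cong]
  have word: "word_of_rees u \<in> free_act M (X \<union> Y')" if "u \<in> free_act M Y" "fst u \<noteq> B" for u
    using that Y'[of "fst u"] by (auto simp: word_of_rees_def free_act_def)
  have shift: "word_of_rees (free_action M u m) = free_action M (word_of_rees u) m"
    "fst (free_action M u m) = fst u" for u m
    by (simp_all add: word_of_rees_def free_action_def)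
  \<comment> \<open>The action keeps the generator of a word and keeps words over \<open>X\<close>
    inside \<open>free_act M X\<close>, so the collapsed part is closed under it.\<close>
  have Z_shift: "Z (free_action M u m)" if "Z u" "m \<in> carrier M" for u m
    using that act_congruenceD(5)[OF cong _ that(2)] free_action_closed[OF M, of X] shift
    unfolding Z_def closed_under_def by metis
  \<comment> \<open>Invariance of \<open>Z\<close> under \<rho> settles the mixed cases of
    transitivity, where one pair is related through \<open>Z\<close> and the other through
    \<rho>.\<close>
  have Z_\<rho>: "Z v" if "Z u" "(word_of_rees u, word_of_rees v) \<in> \<rho>" "fst u \<noteq> B" for u v
    using that unfolding Z_def by blast
  show ?thesis
  proof (rule act_congruenceI, goal_cases)
    case (2 u)
    then show ?case using word act_congruenceD(2)[OF cong] unfolding Z_def by blast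
  next
    case (4 u v w)
    then show ?case using Z_\<rho> by blast
  next
    case (5 u v m)
    moreover have "free_action M u m \<in> free_act M Y" "free_action M v m \<in> free_act M Y"
      using 5 free_action_closed[OF M, of Y] by (auto simp: closed_under_def)
    ultimately show ?case
      using Z_shift[of u m] Z_shift[of v m] act_congruenceD(5)[OF cong _ 5(2)]
      unfolding mem_Collect_eq prod.case mem_Times_iff fst_conv snd_conv shift by blast
  qed auto
qed

theorem theorem4p3:
  fixes M :: "('m, 'k) monoid_scheme"
    and A B X Y' :: "'a set"
    and act :: "'a \<Rightarrow> 'm \<Rightarrow> 'a"
    and Y :: "'a set set"
    and R S\<^sub>1 S\<^sub>2 :: "(('a \<times> 'm) \<times> ('a \<times> 'm)) set"
    and S :: "(('a set \<times> 'm) \<times> ('a set \<times> 'm)) set"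
    and \<alpha> :: "'a \<times> 'm \<Rightarrow> 'a \<times> 'm"
    and z :: "'a \<times> 'm"
  assumes "monoid_act M A act"
    and "subact M A act B"
    and "defined_by M B act X R"
    and "defined_by M (rees_quotient A B) (rees_action A act B) Y S"
    and "Y' = the_elem ` (Y - {B})"
    and "\<not> closed_under M act (A - B) \<Longrightarrow>
           \<forall>w\<in>free_act M Y'. represented (rees_action A act B) (word_to_rees w) = B \<longrightarrow>
             \<alpha> w \<in> free_act M X \<and> represented act w = represented act (\<alpha> w)"
    and "\<not> closed_under M act (A - B) \<Longrightarrow>
           z \<in> free_act M Y' \<and> represented (rees_action A act B) (word_to_rees z) = B"
    and "S\<^sub>1 = map_prod word_of_rees word_of_rees `
           {(u, v). (u, v) \<in> S \<and> (\<exists>a\<in>A - B. represented (rees_action A act B) u = {a})}"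
    and "S\<^sub>2 = (if closed_under M act (A - B) then {}
           else {(u, \<alpha> u) | u. u \<in> free_act M Y' \<and>
                   represented (rees_action A act B) (word_to_rees u) = B \<and>
                   (\<exists>v\<in>free_act M Y. (word_to_rees u, v) \<in> S \<union> S\<inverse>)}
                \<union> {(z, \<alpha> z)})"
  shows "defined_by M A act (X \<union> Y') (R \<union> S\<^sub>1 \<union> S\<^sub>2)"
proof -
  interpret monoid_act M A act by (rule assms(1))
  let ?F = "free_act M (X \<union> Y')" and ?ract = "rees_action A act B"
  let ?T = "R \<union> S\<^sub>1 \<union> S\<^sub>2"
  define \<rho> where "\<rho> = congruence_generated M ?F (free_action M) ?T"
  have B: "B \<noteq> {}" "B \<subseteq> A" using assms(2) by (auto simp: subact_def)
  interpret B: monoid_act M B act by (rule monoid_act_subact[OF assms(1,2)])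
  note X = defined_byD[OF monoid_axioms assms(3)]
  note Y = defined_byD[OF monoid_axioms assms(4)]
  have Y_cases: "C = B \<or> (\<exists>a\<in>A - B. C = {a})" if "C \<in> Y" for C
    using Y(2) that rees_quotient_iff[OF B] by blast
  \<comment> \<open>\<open>B\<close> may itself be a singleton, so \<open>{y} \<in> Y\<close> alone
    does not suffice; \<open>y \<in> A - B\<close> rules out the zero class.\<close>
  have Y'_iff: "y \<in> Y' \<longleftrightarrow> {y} \<in> Y \<and> y \<in> A - B" for y
  proof
    assume "y \<in> Y'"
    then obtain C where C: "C \<in> Y" "C \<noteq> B" "y = the_elem C" using assms(5) by auto
    with Y_cases show "{y} \<in> Y \<and> y \<in> A - B" by fastforce
  next
    assume "{y} \<in> Y \<and> y \<in> A - B"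
    then have "{y} \<in> Y - {B}" by auto
    then show "y \<in> Y'" unfolding assms(5) by (metis image_eqI the_elem_eq)
  qed
  have XY': "X \<union> Y' \<subseteq> A" using X(2) B Y'_iff by auto
  note sub = free_act_mono[of X "X \<union> Y'" M] free_act_mono[of Y' "X \<union> Y'" M]

  \<comment> \<open>Translation between words over Y' and words over Y\<close>
  have to_rees: "word_to_rees w \<in> free_act M Y" "fst (word_to_rees w) \<noteq> B"
      "word_of_rees (word_to_rees w) = w"
      "represented ?ract (word_to_rees w) =
         (if represented act w \<in> B then B else {represented act w})"
    if "w \<in> free_act M Y'" for w
    using that rees_action_singleton[OF assms(2)]
    by (auto simp: free_act_def word_to_rees_def word_of_rees_def represented_def Y'_iff)
  have zero: "represented ?ract (word_to_rees w) = B \<longleftrightarrow> represented act w \<in> B"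
    if "w \<in> free_act M Y'" for w
    using to_rees(4)[OF that] by auto
  have of_rees: "\<exists>w\<in>free_act M Y'. u = word_to_rees w"
    if "u \<in> free_act M Y" "fst u \<noteq> B" for u
    using that Y_cases Y'_iff
    by (fastforce simp: free_act_def word_to_rees_def)
  have rep_zero: "represented ?ract u = B" if "u \<in> free_act M Y" "fst u = B" for u
    using that rees_action_zero[OF assms(2)] by (auto simp: represented_def free_act_def)
  have of_rees_nonzero: "\<exists>w\<in>free_act M Y'. u = word_to_rees w \<and> represented act w = a"
    if "u \<in> free_act M Y" "represented ?ract u = {a}" "a \<in> A - B" for u a
  proof -
    have "{a} \<noteq> B" using that(3) by auto
    then have "fst u \<noteq> B" using rep_zero[of u] that(1,2) by metis
    with that(1) obtain w where w: "w \<in> free_act M Y'" "u = word_to_rees w" using of_rees by blast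
    then have "represented act w = a"
      using to_rees(4)[OF w(1)] that(2) \<open>{a} \<noteq> B\<close> by (auto split: if_splits)
    then show ?thesis using w by blast
  qed
  \<comment> \<open>The generator of \<open>w\<close> lies in \<open>A - B\<close> and is moved into
    \<open>B\<close>. So a single such word makes the hypotheses on \<alpha> and \<open>z\<close>
    and the non-empty form of \<open>S\<^sub>2\<close> available.\<close>
  have not_closed: "\<not> closed_under M act (A - B)"
    if "w \<in> free_act M Y'" "represented act w \<in> B" for w
    using that by (fastforce simp: free_act_def represented_def closed_under_def Y'_iff)
  have S_rep: "u \<in> free_act M Y" "v \<in> free_act M Y" "represented ?ract u = represented ?ract v"
    if "(u, v) \<in> S" for u v
    using that Y(4) congruence_generated_superset[of S M "free_act M Y" "free_action M"]
    by (auto simp: representation_kernel_def)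
  have \<alpha>: "\<alpha> w \<in> free_act M X" "represented act w = represented act (\<alpha> w)"
    if "w \<in> free_act M Y'" "represented act w \<in> B" for w
    using assms(6)[OF not_closed[OF that]] that zero by blast+

  \<comment> \<open>Validity of the relations in A\<close>
  have T: "?T \<subseteq> representation_kernel M act (X \<union> Y')"
  proof (intro Un_least)
    show "R \<subseteq> representation_kernel M act (X \<union> Y')"
      using congruence_generated_superset[of R M "free_act M X" "free_action M"] X(4) sub
      by (auto simp: representation_kernel_def)
    show "S\<^sub>1 \<subseteq> representation_kernel M act (X \<union> Y')"
    proof
      fix p assume "p \<in> S\<^sub>1"
      then obtain u v a where uv: "(u, v) \<in> S" "a \<in> A - B" "represented ?ract u = {a}"
        and p: "p = (word_of_rees u, word_of_rees v)"
        unfolding assms(8) by auto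
      \<comment> \<open>Both sides of the relation represent the same non-zero element, so neither
        generator is the zero and both sides translate to words over \<open>Y'\<close>.\<close>
      obtain w w' where "w \<in> free_act M Y'" "u = word_to_rees w" "represented act w = a"
        and "w' \<in> free_act M Y'" "v = word_to_rees w'" "represented act w' = a"
        using of_rees_nonzero S_rep[OF uv(1)] uv by metis
      then show "p \<in> representation_kernel M act (X \<union> Y')"
        using p to_rees(3) sub by (auto simp: representation_kernel_def)
    qed
    have \<alpha>_kernel: "(w, \<alpha> w) \<in> representation_kernel M act (X \<union> Y')"
      if "w \<in> free_act M Y'" "represented act w \<in> B" for w
      using \<alpha>[OF that] that sub by (auto simp: representation_kernel_def)
    show "S\<^sub>2 \<subseteq> representation_kernel M act (X \<union> Y')"
      using assms(7) unfolding assms(9) by (auto simp: zero \<alpha>_kernel)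
  qed
  have cong: "act_congruence M ?F (free_action M) \<rho>"
    unfolding \<rho>_def
  proof (rule act_congruence_generated)
    show "?T \<subseteq> ?F \<times> ?F" using T by (auto simp: representation_kernel_def)
  qed (rule free_action_closed[OF monoid_axioms])
  have T_\<rho>: "?T \<subseteq> \<rho>" unfolding \<rho>_def by (rule congruence_generated_superset)
  have \<rho>_rep: "represented act u = represented act v" if "(u, v) \<in> \<rho>" for u v
    using that congruence_generated_least[OF act_congruence_representation_kernel[OF XY'] T]
    by (auto simp: \<rho>_def representation_kernel_def)

  \<comment> \<open>The collapsed congruence on the free act on Y\<close>
  define Z where "Z u \<longleftrightarrow> fst u = B \<or> (\<exists>\<beta>\<in>free_act M X. (word_of_rees u, \<beta>) \<in> \<rho>)" for u
  define \<sigma> where "\<sigma> = {(u, v) \<in> free_act M Y \<times> free_act M Y.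
      Z u \<and> Z v \<or> fst u \<noteq> B \<and> fst v \<noteq> B \<and> (word_of_rees u, word_of_rees v) \<in> \<rho>}"
  have \<sigma>: "act_congruence M (free_act M Y) (free_action M) \<sigma>"
    unfolding \<sigma>_def Z_def
    by (rule act_congruence_collapse[OF monoid_axioms cong]) (simp add: assms(5))
  \<comment> \<open>A side with value zero either has the zero as generator or is a word
    \<open>w\<close> over \<open>Y'\<close>, which \<open>S\<^sub>2\<close> ties to
    \<open>\<alpha> w\<close>. The converse of \<open>S\<close> is included so that right-hand sides
    are covered too.\<close>
  have Z_S: "Z u" if "u \<in> free_act M Y" "v \<in> free_act M Y" "(u, v) \<in> S \<union> S\<inverse>"
    "represented ?ract u = B" for u v
  proof (cases "fst u = B")
    case False
    with that(1) obtain w where w: "w \<in> free_act M Y'" "u = word_to_rees w"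
      using of_rees by blast
    then have rep: "represented act w \<in> B" using zero that(4) by blast
    have "(w, \<alpha> w) \<in> S\<^sub>2"
      using w that unfolding assms(9) if_not_P[OF not_closed[OF w(1) rep]] by blast
    then show ?thesis
      using T_\<rho> \<alpha>(1)[OF w(1) rep] w to_rees(3) by (auto simp: Z_def)
  qed (simp add: Z_def)
  have "S \<subseteq> \<sigma>"
  proof
    fix p assume "p \<in> S"
    then obtain u v where p: "p = (u, v)" and uv: "(u, v) \<in> S" by (cases p) auto
    note F = S_rep[OF uv]
    have "represented ?ract u \<in> rees_quotient A B" using Y(5) F(1) by blast
    then consider "represented ?ract u = B" | a where "a \<in> A - B" "represented ?ract u = {a}"
      using rees_quotient_iff[OF B] by blast
    then have "(u, v) \<in> \<sigma>"
    proof cases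
      case 1
      then show ?thesis using Z_S[of u v] Z_S[of v u] F uv by (auto simp: \<sigma>_def)
    next
      case (2 a)
      then have "(word_of_rees u, word_of_rees v) \<in> S\<^sub>1" using uv unfolding assms(8) by force
      moreover have "fst u \<noteq> B" "fst v \<noteq> B"
        using rep_zero[of u] rep_zero[of v] F 2 by auto
      ultimately show ?thesis using F T_\<rho> by (auto simp: \<sigma>_def)
    qed
    then show "p \<in> \<sigma>" by (simp add: p)
  qed
  \<comment> \<open>\<open>S\<close> generates equality in \<open>A/B\<close>, so every equality
    there is now witnessed by \<open>Z\<close> or by \<rho>.\<close>
  then have ker_\<sigma>: "representation_kernel M ?ract Y \<subseteq> \<sigma>"
    using congruence_generated_least[OF \<sigma>] Y(4) by metis
  have eq_\<sigma>: "(word_to_rees u, word_to_rees v) \<in> \<sigma>"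
    if "u \<in> free_act M Y'" "v \<in> free_act M Y'"
      "represented ?ract (word_to_rees u) = represented ?ract (word_to_rees v)" for u v
    using ker_\<sigma> that to_rees(1)[of u] to_rees(1)[of v] by (auto simp: representation_kernel_def)

  \<comment> \<open>Reduction of words with value in B to words over X\<close>
  have to_X: "\<exists>\<beta>\<in>free_act M X. (w, \<beta>) \<in> \<rho>" if w: "w \<in> ?F" "represented act w \<in> B" for w
  proof (cases "w \<in> free_act M X")
    case True
    then show ?thesis using act_congruenceD(2)[OF cong w(1)] by blast
  next
    case False
    then have w': "w \<in> free_act M Y'" using w by (auto simp: free_act_def)
    note nc = not_closed[OF w' w(2)]
    have z: "z \<in> free_act M Y'" "represented act z \<in> B" using assms(7)[OF nc] zero[of z] by simp_all
    have z\<rho>: "(z, \<alpha> z) \<in> \<rho>" using T_\<rho> nc unfolding assms(9) by auto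
    \<comment> \<open>Both words are zero in \<open>A/B\<close>. Either \<open>w\<close> is
      collapsed, which already gives a word over \<open>X\<close>, or \<open>w\<close> is
      \<rho>-related to \<open>z\<close> and thereby to \<open>\<alpha> z\<close>.\<close>
    have "(word_to_rees w, word_to_rees z) \<in> \<sigma>"
      using w' z w(2) by (intro eq_\<sigma>) (simp_all add: to_rees(4))
    then consider "Z (word_to_rees w)" | "(w, z) \<in> \<rho>"
      by (auto simp: \<sigma>_def to_rees(3)[OF w'] to_rees(3)[OF z(1)])
    then show ?thesis
    proof cases
      case 1
      then show ?thesis using to_rees(2,3)[OF w'] by (simp add: Z_def)
    next
      case 2
      then show ?thesis using act_congruenceD(4)[OF cong _ z\<rho>] \<alpha>(1)[OF z] by blast
    qed
  qed
  have R_\<rho>: "(u, v) \<in> \<rho>"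
    if "u \<in> free_act M X" "v \<in> free_act M X" "represented act u = represented act v" for u v
  proof -
    \<comment> \<open>The restriction of \<rho> to words over \<open>X\<close> is a congruence
      containing \<open>R\<close>, hence contains equality of values in \<open>B\<close>.\<close>
    have "act_congruence M (free_act M X) (free_action M) (\<rho> \<inter> free_act M X \<times> free_act M X)"
      by (intro act_congruence_restrict[OF cong] free_action_closed monoid_axioms sub) simp
    then have "congruence_generated M (free_act M X) (free_action M) R
                 \<subseteq> \<rho> \<inter> free_act M X \<times> free_act M X"
      by (rule congruence_generated_least) (use X(3) T_\<rho> in blast)
    then have "representation_kernel M act X \<subseteq> \<rho>" unfolding X(4) by blast
    then show ?thesis using that by (auto simp: representation_kernel_def)
  qed

  \<comment> \<open>Completeness of the relations and generation of A\<close>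
  show ?thesis
  proof (rule defined_byI)
    show "X \<union> Y' \<noteq> {}" using X(1) by simp
    show "representation_kernel M act (X \<union> Y')
            \<subseteq> congruence_generated M ?F (free_action M) ?T"
      unfolding \<rho>_def[symmetric]
    proof (rule subrelI)
      fix u v assume "(u, v) \<in> representation_kernel M act (X \<union> Y')"
      then have uv: "u \<in> ?F" "v \<in> ?F" "represented act u = represented act v"
        by (auto simp: representation_kernel_def)
      show "(u, v) \<in> \<rho>"
      proof (cases "represented act u \<in> B")
        case True
        then obtain \<beta> \<gamma> where \<beta>: "\<beta> \<in> free_act M X" "(u, \<beta>) \<in> \<rho>"
          and \<gamma>: "\<gamma> \<in> free_act M X" "(v, \<gamma>) \<in> \<rho>"
          using to_X[OF uv(1)] to_X[OF uv(2)] uv(3) by auto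
        have "(\<beta>, \<gamma>) \<in> \<rho>"
          using R_\<rho>[OF \<beta>(1) \<gamma>(1)] \<rho>_rep[OF \<beta>(2)] \<rho>_rep[OF \<gamma>(2)] uv(3) by simp
        with \<beta>(2) \<gamma>(2) show ?thesis using act_congruenceD(3,4)[OF cong] by blast
      next
        case False
        \<comment> \<open>A word over \<open>X\<close> has its value in the subact \<open>B\<close>,
          so neither word is over \<open>X\<close>.\<close>
        then have Y': "u \<in> free_act M Y'" "v \<in> free_act M Y'"
          using uv B.represented_in[OF X(2), of u] B.represented_in[OF X(2), of v]
          by (auto simp: free_act_def)
        \<comment> \<open>Otherwise \<open>u\<close> would be \<rho>-related to a word over
          \<open>X\<close>, and since \<rho> preserves values, its value would lie in
          \<open>B\<close>. Only the \<rho>-alternative of \<sigma> remains.\<close>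
        have "\<not> Z (word_to_rees u)"
          unfolding Z_def to_rees(3)[OF Y'(1)]
          using False \<rho>_rep[of u] B.represented_in[OF X(2)] to_rees(2)[OF Y'(1)] by auto
        moreover have "(word_to_rees u, word_to_rees v) \<in> \<sigma>"
          using Y' uv(3) by (intro eq_\<sigma>) (simp_all add: to_rees(4))
        ultimately show ?thesis using Y' by (auto simp: \<sigma>_def to_rees(3))
      qed
    qed
    show "A \<subseteq> represented act ` ?F"
    proof
      fix a assume a: "a \<in> A"
      show "a \<in> represented act ` ?F"
      proof (cases "a \<in> B")
        case True
        then have "a \<in> represented act ` free_act M X" using X(5) by simp
        then show ?thesis using sub by auto
      next
        case False
        then have "{a} \<in> represented ?ract ` free_act M Y"
          unfolding Y(5) using a rees_quotient_iff[OF B] by blast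
        then obtain u where "u \<in> free_act M Y" "represented ?ract u = {a}" by auto
        then obtain w where "w \<in> free_act M Y'" "represented act w = a"
          using of_rees_nonzero a False by blast
        then show ?thesis using sub by auto
      qed
    qed
  qed (fact XY' T)+
qed

end
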